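(* Let $r\ge 2$ and let $K_1, K_2, \dots, K_r$ be proximinal subsets of a real Hilbert space $\mathcal{H}$ with $\bigcap_{j=1}^r K_j\neq\varnothing$. Suppose that $P_{K_{r-1}}(K_r) \subseteq K_r$. Let $V, W, Q_V, P_W, R_W$ be as defined in the context, and let $T := \operatorname{I} - P_W + Q_VR_W$ be the constraint-reduced DR operator on $\mathcal{H}^{r-1}$. Then the following statements hold. (a) $P_W(\operatorname{Fix} T) = V\cap W$. In particular, if $(x_1,x_2,\dots,x_{r-1}) \in \operatorname{Fix} T$, then $\frac{1}{r-1}\sum_{j=1}^{r-1} x_j \in \bigcap_{j=1}^r K_j$. (b) If $K_r$ is affine, then $T = (\operatorname{I} + R_VR_W)/2$, i.e. $T$ coincides with the DR operator for $W$ and $V$. (c) If $K_1, \dots, K_{r-1}$ are convex and $K_r$ is affine, then $T$ is firmly nonexpansive. Consequently, for any $\mathbf{x}_0\in \mathcal{H}^{r-1}$, the sequence $(\mathbf{x}_n)_{n\in \mathbb{N}}$ generated by $\mathbf{x}_{n+1} = T(\mathbf{x}_n)$ converges weakly to a point $\mathbf{x}^\ast = (x_1^\ast, x_2^\ast, \dots, x_{r-1}^\ast) \in \operatorname{Fix} T$. Moreover, writing $\mathbf{x}_n = (x_{1,n}, x_{2,n}, \dots, x_{r-1,n})$, the sequence $\left(\frac{1}{r-1}\sum_{j=1}^{r-1} x_{j,n}\right)_{n\in \mathbb{N}}$ converges weakly to $\frac{1}{r-1}\sum_{j=1}^{r-1} x_j^\ast \in \bigcap_{j=1}^r K_j$.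
   Context: $\mathcal{H}^{r-1}$ is the product Hilbert space with inner product $\langle\mathbf{x},\mathbf{y}\rangle=\sum_{j}\langle x_j,y_j\rangle$. For a nonempty subset $C$ of a Hilbert space, the projector is the set-valued operator $P_C(x)=\{c\in C:\|x-c\|=\inf_{z\in C}\|x-z\|\}$ and the reflector is $R_C:=2P_C-\operatorname{I}$ (sums understood as Minkowski sums); both are regarded as single-valued maps when their values are singletons. $C$ is proximinal if it is nonempty and $P_C(x)\ne\varnothing$ for every $x$. For a set-valued operator $P$ and a set $K$, $P(K)=\bigcup_{x\in K}P(x)$; compositions of set-valued operators are $PP'(x)=P(P'(x))$. $\operatorname{Fix}T=\{x:x\in T(x)\}$. Define $$V := K_1\times \cdots \times K_{r-2} \times (K_{r-1}\cap K_r),\qquad W := \{(x_1,\dots,x_{r-1})\in\mathcal{H}^{r-1} : x_1=\cdots=x_{r-1}\},$$ $$Q_V(\mathbf{x}) := P_{K_1}(x_1)\times\cdots\times P_{K_{r-2}}(x_{r-2})\times P_{K_{r-1}}P_{K_r}(x_{r-1}),\qquad P_W(\mathbf{x}) := \Big(\tfrac{1}{r-1}\sum_{j=1}^{r-1}x_j,\dots,\tfrac{1}{r-1}\sum_{j=1}^{r-1}x_j\Big),$$ so that $P_W$ is the projector onto $W$ and $R_W=2P_W-\operatorname{I}$; thus $T(\mathbf{x})=\mathbf{x}-P_W(\mathbf{x})+Q_V(2P_W(\mathbf{x})-\mathbf{x})$, in general set-valued. The DR operator for nonempty sets $A$ and $B$ is $T_{A,B}:=\frac{\operatorname{I}+R_BR_A}{2}$.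 A single-valued operator $T$ is firmly nonexpansive if $\|T(x)-T(y)\|^2+\|(\operatorname{I}-T)(x)-(\operatorname{I}-T)(y)\|^2\le\|x-y\|^2$ for all $x,y$. *)

theory Defs
  imports "HOL-Analysis.Analysis"
begin

text \<open>A set-valued operator is a function \<open>'a \<Rightarrow> 'b set\<close>.\<close>

definition proj :: "'a::real_inner set \<Rightarrow> 'a \<Rightarrow> 'a set" where
  "proj C x = {c \<in> C. norm (x - c) = (INF z\<in>C. norm (x - z))}"

definition proximinal :: "'a::real_inner set \<Rightarrow> bool" where
  "proximinal C \<longleftrightarrow> C \<noteq> {} \<and> (\<forall>x. proj C x \<noteq> {})"

definition reflector :: "'a::real_inner set \<Rightarrow> 'a \<Rightarrow> 'a set" where
  "reflector C x = {2 *\<^sub>R c - x | c. c \<in> proj C x}"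

definition sv_image :: "('a \<Rightarrow> 'b set) \<Rightarrow> 'a set \<Rightarrow> 'b set" where
  "sv_image P S = (\<Union>x\<in>S. P x)"

definition sv_comp :: "('b \<Rightarrow> 'c set) \<Rightarrow> ('a \<Rightarrow> 'b set) \<Rightarrow> 'a \<Rightarrow> 'c set" where
  "sv_comp P P' x = sv_image P (P' x)"

definition Fix :: "('a \<Rightarrow> 'a set) \<Rightarrow> 'a set" where
  "Fix T = {x. x \<in> T x}"

definition DR_op :: "'a::real_inner set \<Rightarrow> 'a set \<Rightarrow> 'a \<Rightarrow> 'a set" where
  "DR_op A B x = {(1/2) *\<^sub>R (x + z) | z. z \<in> sv_comp (reflector B) (reflector A) x}"

definition firmly_nonexpansive :: "('a::real_inner \<Rightarrow> 'a) \<Rightarrow> bool" where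
  "firmly_nonexpansive F \<longleftrightarrow>
     (\<forall>x y. (norm (F x - F y))\<^sup>2 + (norm ((x - F x) - (y - F y)))\<^sup>2 \<le> (norm (x - y))\<^sup>2)"

definition weakly_converges :: "(nat \<Rightarrow> 'a::real_inner) \<Rightarrow> 'a \<Rightarrow> bool" where
  "weakly_converges s l \<longleftrightarrow> (\<forall>u. (\<lambda>n. inner (s n) u) \<longlonglongrightarrow> inner l u)"

text \<open>The product space \<open>H\<^sup>r\<^sup>-\<^sup>1\<close> is the type \<open>'a ^ 'n\<close>, whose inner product is the sum of the
  componentwise inner products. An enumeration \<open>e\<close>, a bijection from \<open>{1..r-1}\<close> onto the index
  type \<open>'n\<close>, attaches the labels \<open>1, ..., r-1\<close> to the coordinates: \<open>x $ e j\<close> is the component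
  \<open>x\<^sub>j\<close>. In particular \<open>CARD('n) = r - 1\<close>.\<close>

definition prodV :: "(nat \<Rightarrow> 'n::finite) \<Rightarrow> nat \<Rightarrow> (nat \<Rightarrow> 'a::real_inner set) \<Rightarrow> ('a ^ 'n) set" where
  "prodV e r K = {x. (\<forall>j\<in>{1..r-2}. x $ e j \<in> K j) \<and> x $ e (r-1) \<in> K (r-1) \<inter> K r}"

definition diagW :: "('a::real_inner ^ 'n::finite) set" where
  "diagW = {x. \<forall>i j. x $ i = x $ j}"

definition Q_V :: "(nat \<Rightarrow> 'n::finite) \<Rightarrow> nat \<Rightarrow> (nat \<Rightarrow> 'a::real_inner set) \<Rightarrow> 'a ^ 'n \<Rightarrow> ('a ^ 'n) set" where
  "Q_V e r K x = {y. (\<forall>j\<in>{1..r-2}. y $ e j \<in> proj (K j) (x $ e j)) \<and>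
     y $ e (r-1) \<in> sv_comp (proj (K (r-1))) (proj (K r)) (x $ e (r-1))}"

definition mean :: "'a::real_inner ^ 'n::finite \<Rightarrow> 'a" where
  "mean x = (1 / real CARD('n)) *\<^sub>R (\<Sum>i\<in>UNIV. x $ i)"

definition P_W :: "'a::real_inner ^ 'n::finite \<Rightarrow> 'a ^ 'n" where
  "P_W x = (\<chi> i. mean x)"

definition R_W :: "'a::real_inner ^ 'n::finite \<Rightarrow> 'a ^ 'n" where
  "R_W x = 2 *\<^sub>R P_W x - x"

definition cr_DR_op ::
    "(nat \<Rightarrow> 'n::finite) \<Rightarrow> nat \<Rightarrow> (nat \<Rightarrow> 'a::real_inner set) \<Rightarrow> 'a ^ 'n \<Rightarrow> ('a ^ 'n) set" where
  "cr_DR_op e r K x = {x - P_W x + q | q. q \<in> Q_V e r K (R_W x)}"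

lemma proj_diagW: "proj diagW x = {P_W x}"
proof -
  have W: "P_W x \<in> diagW" by (simp add: P_W_def diagW_def)
  have orth: "inner (x - P_W x) (P_W x - z) = 0" if z: "z \<in> diagW" for z
  proof -
    define c where "c = z $ undefined"
    have c: "z $ i = c" for i using z by (simp add: diagW_def c_def)
    have "inner (x - P_W x) (P_W x - z) = inner (\<Sum>i\<in>UNIV. x $ i - mean x) (mean x - c)"
      by (simp add: inner_vec_def P_W_def c inner_sum_left)
    also have "(\<Sum>i\<in>UNIV. x $ i - mean x) = 0"
      by (simp add: sum_subtractf mean_def sum_constant_scaleR)
    finally show ?thesis by simp
  qed
  have pyth: "(norm (x - z))\<^sup>2 = (norm (x - P_W x))\<^sup>2 + (norm (P_W x - z))\<^sup>2" if "z \<in> diagW" for z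
    using norm_add_Pythagorean[of "x - P_W x" "P_W x - z"] orth[OF that]
    by (simp add: orthogonal_def)
  have le: "norm (x - P_W x) \<le> norm (x - z)" if "z \<in> diagW" for z
  proof (rule power2_le_imp_le)
    show "(norm (x - P_W x))\<^sup>2 \<le> (norm (x - z))\<^sup>2"
      unfolding pyth[OF that] by simp
  qed simp
  have inf: "(INF z\<in>diagW. norm (x - z)) = norm (x - P_W x)"
    by (intro cInf_eq_minimum imageI W) (auto intro: le)
  have "c = P_W x" if "c \<in> diagW" "norm (x - c) = norm (x - P_W x)" for c
    proof -
    have "(norm (P_W x - c))\<^sup>2 = 0" using pyth[OF that(1)] unfolding that(2) by linarith
    then show ?thesis by simp
  qed
  then show ?thesis using W by (auto simp: proj_def inf)
qed

lemma reflector_diagW: "reflector diagW x = {R_W x}"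
  by (simp add: reflector_def R_W_def proj_diagW)

end

theory Submission
  imports Defs
begin

text \<open>
  The operator \<open>T = I - P\<^sub>W + Q\<^sub>V R\<^sub>W\<close> replaces the projector onto the product set \<open>V\<close>, whose last
  factor \<open>K\<^sub>r\<^sub>-\<^sub>1 \<inter> K\<^sub>r\<close> is an intersection, by the composition \<open>P\<^sub>K\<^sub>r\<^sub>-\<^sub>1 P\<^sub>K\<^sub>r\<close> in that factor.

  A point \<open>x\<close> is fixed by \<open>T\<close> exactly when the constant vector \<open>P\<^sub>W x\<close> lies in \<open>Q\<^sub>V (R\<^sub>W x)\<close>. The
  values of \<open>Q\<^sub>V\<close> lie in \<open>V\<close>: the inclusion \<open>P\<^sub>K\<^sub>r\<^sub>-\<^sub>1(K\<^sub>r) \<subseteq> K\<^sub>r\<close> puts the last component into both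
  \<open>K\<^sub>r\<^sub>-\<^sub>1\<close> and \<open>K\<^sub>r\<close>. Conversely every point of \<open>V \<inter> W\<close> is fixed, because projectors fix the points
  of their sets. This is statement (a).

  If \<open>K\<^sub>r\<close> is affine, the squared distance from \<open>x\<close> to a point of \<open>K\<^sub>r\<close> splits by Pythagoras into a
  constant and the squared distance from \<open>P\<^sub>K\<^sub>r x\<close>. Hence the nearest points of \<open>K\<^sub>r\<^sub>-\<^sub>1 \<inter> K\<^sub>r\<close> to
  \<open>x\<close> are those of \<open>K\<^sub>r\<^sub>-\<^sub>1\<close> to \<open>P\<^sub>K\<^sub>r x\<close> (lemma \<open>proj_Int_affine\<close>). As projectors onto products act
  factorwise (\<open>proj_product\<close>), \<open>Q\<^sub>V\<close> is the projector onto \<open>V\<close>, which gives (b).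

  Under the convexity assumptions \<open>T\<close> is therefore a Douglas--Rachford operator of two convex sets,
  and its firm nonexpansiveness follows from that of the two projectors (\<open>firmly_nonexpansive_DR\<close>).
  Weak convergence of the iterates to a fixed point is obtained without weak compactness, from
  asymptotic centers (\<open>nonexpansive_iteration_weakly_converges\<close>). The center of a bounded sequence
  along a filter is the point \<open>z\<close> for which the infimum of the radii of balls about \<open>z\<close> that
  eventually contain the sequence is smallest, in short the center of the smallest ball; it exists
  and is unique (\<open>asymptotic_center_exists\<close>) by the parallelogram law and
  completeness. If consecutive iterates of a nonexpansive map approach each other, such a center is
  a fixed point, and the iterates do not move away from fixed points. Consequently passing to a
  subsequence cannot shrink the smallest ball. If the iterates had a component in some direction
  \<open>u\<close>, relative to the center \<open>z\<close>, that is infinitely often at least \<open>\<epsilon> > 0\<close>, then moving the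
  center a little towards \<open>u\<close> would shrink the ball for that subsequence. So the whole sequence
  converges weakly to \<open>z\<close>. Averaging is continuous and linear, so the means converge weakly as well.
\<close>

section \<open>Nearest points\<close>

lemma mem_proj_iff:
  "c \<in> proj C x \<longleftrightarrow> c \<in> C \<and> (\<forall>z\<in>C. norm (x - c) \<le> norm (x - z))"
proof -
  have bdd: "bdd_below ((\<lambda>z. norm (x - z)) ` C)"
    by (rule bdd_belowI[where m = 0]) auto
  have "norm (x - c) = (INF z\<in>C. norm (x - z))"
    if "c \<in> C" "\<forall>z\<in>C. norm (x - c) \<le> norm (x - z)"
    using that by (intro cInf_eq_minimum[symmetric]) auto
  moreover have "norm (x - c) \<le> norm (x - z)"
    if "norm (x - c) = (INF z\<in>C. norm (x - z))" "z \<in> C" for z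
    using cINF_lower[OF bdd that(2)] that(1) by simp
  ultimately show ?thesis by (auto simp: proj_def)
qed

lemma proj_self: "x \<in> C \<Longrightarrow> x \<in> proj C x"
  by (simp add: mem_proj_iff)

lemma proj_subset: "proj C x \<subseteq> C"
  by (auto simp: mem_proj_iff)

text \<open>A segment that leaves the nearest point at an acute angle to \<open>x - c\<close> would contain points
  closer to \<open>x\<close>.\<close>

lemma proj_convex_obtuse:
  assumes "convex C" "c \<in> proj C x" "z \<in> C"
  shows "inner (x - c) (z - c) \<le> 0"
proof (rule ccontr)
  assume "\<not> ?thesis"
  then obtain u where u: "u > 0" "u \<le> 1" "dist (c + u *\<^sub>R (z - c)) x < dist c x"
    using closer_point_lemma[of x c z] by auto
  have "(1 - u) *\<^sub>R c + u *\<^sub>R z \<in> C"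
    using convexD_alt[OF assms(1)] assms(2,3) u by (auto simp: mem_proj_iff)
  also have "(1 - u) *\<^sub>R c + u *\<^sub>R z = c + u *\<^sub>R (z - c)"
    by (simp add: algebra_simps)
  finally have "norm (x - c) \<le> norm (x - (c + u *\<^sub>R (z - c)))"
    using assms(2) by (auto simp: mem_proj_iff)
  with u(3) show False by (simp add: dist_norm norm_minus_commute)
qed

text \<open>Firm nonexpansiveness of the projector, in its inner product form: the obtuse angle
  conditions at \<open>p\<close> and at \<open>q\<close>, each tested with the other point, add up to it.\<close>

lemma proj_convex_firm:
  assumes "convex C" "p \<in> proj C x" "q \<in> proj C y"
  shows "(norm (p - q))\<^sup>2 \<le> inner (p - q) (x - y)"
proof -
  have "inner (x - p) (q - p) \<le> 0" "inner (y - q) (p - q) \<le> 0"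
    using proj_convex_obtuse[OF assms(1)] assms(2,3) by (auto simp: mem_proj_iff)
  then show ?thesis
    unfolding power2_norm_eq_inner by (simp add: inner_simps inner_commute)
qed

lemma proj_convex_unique:
  assumes "convex C" "p \<in> proj C x" "q \<in> proj C x"
  shows "p = q"
  using proj_convex_firm[OF assms] by simp

text \<open>In an affine set the segment from \<open>z\<close> to the nearest point \<open>b\<close> extends beyond \<open>b\<close>, so the
  obtuse angle is a right angle.\<close>

lemma proj_affine_Pythagoras:
  assumes "affine B" "b \<in> proj B x" "z \<in> B"
  shows "(norm (x - z))\<^sup>2 = (norm (x - b))\<^sup>2 + (norm (b - z))\<^sup>2"
proof -
  have convB: "convex B" by (rule affine_imp_convex[OF assms(1)])
  have "b \<in> B" using assms(2) by (simp add: mem_proj_iff)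
  have "2 *\<^sub>R b + (-1) *\<^sub>R z \<in> B"
    by (rule mem_affine[OF assms(1) \<open>b \<in> B\<close> assms(3)]) simp
  from proj_convex_obtuse[OF convB assms(2) this] proj_convex_obtuse[OF convB assms(2,3)]
  have "inner (x - b) (b - z) = 0"
    by (simp add: inner_simps)
  then show ?thesis
    using norm_add_Pythagorean[of "x - b" "b - z"] by (simp add: orthogonal_def)
qed

text \<open>On \<open>B\<close>, the distances from \<open>x\<close> and from its nearest point \<open>b\<close> have the same minimizers. The
  inclusion \<open>sv_image (proj A) B \<subseteq> B\<close> makes the nearest points of \<open>A\<close> to \<open>b\<close> compete within
  \<open>A \<inter> B\<close>, and proximinality guarantees that there are any.\<close>

lemma proj_Int_affine:
  assumes "affine B" "proximinal A" "proximinal B" and AB: "sv_image (proj A) B \<subseteq> B"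
  shows "sv_comp (proj A) (proj B) x = proj (A \<inter> B) x"
proof -
  obtain b where b: "b \<in> proj B x" using assms(3) by (auto simp: proximinal_def)
  then have "proj B x = {b}"
    using proj_convex_unique[OF affine_imp_convex[OF assms(1)]] by blast
  then have comp: "sv_comp (proj A) (proj B) x = proj A b"
    by (simp add: sv_comp_def sv_image_def)
  have sub: "proj A b \<subseteq> A \<inter> B"
    using AB b by (auto simp: sv_image_def mem_proj_iff)
  have dist_iff: "norm (x - c) \<le> norm (x - z) \<longleftrightarrow> norm (b - c) \<le> norm (b - z)"
    if "c \<in> B" "z \<in> B" for c z
    using proj_affine_Pythagoras[OF assms(1) b that(1)] proj_affine_Pythagoras[OF assms(1) b that(2)]
    by (smt (verit) norm_ge_zero power2_le_imp_le power_mono)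
  obtain c0 where c0: "c0 \<in> proj A b" using assms(2) by (auto simp: proximinal_def)
  have "c \<in> proj (A \<inter> B) x" if "c \<in> proj A b" for c
  proof -
    have "c \<in> A" "c \<in> B" using that sub by auto
    then show ?thesis using that dist_iff[of c] by (auto simp: mem_proj_iff)
  qed
  moreover have "c \<in> proj A b" if "c \<in> proj (A \<inter> B) x" for c
  proof -
    have c: "c \<in> A" "c \<in> B" using that by (auto simp: mem_proj_iff)
    have "norm (b - c) \<le> norm (b - c0)"
    proof -
      have "c0 \<in> A \<inter> B" using c0 sub by blast
      then show ?thesis using that dist_iff[of c c0] c by (auto simp: mem_proj_iff)
    qed
    with c0 c show ?thesis by (force simp: mem_proj_iff)
  qed
  ultimately show ?thesis unfolding comp by blast
qed

text \<open>The squared norm is a sum over the coordinates, so each coordinate can be minimized on its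
  own: a nearest point of the product remains a competitor when one coordinate is exchanged.\<close>

lemma proj_product:
  fixes C :: "'n::finite \<Rightarrow> 'a::real_inner set"
  shows "proj {y. \<forall>i. y $ i \<in> C i} x = {y. \<forall>i. y $ i \<in> proj (C i) (x $ i)}"
proof -
  have nsq: "(norm v)\<^sup>2 = (\<Sum>i\<in>UNIV. (norm (v $ i))\<^sup>2)" for v :: "'a ^ 'n"
    by (simp add: norm_vec_def L2_set_def sum_nonneg)
  have "y $ i \<in> proj (C i) (x $ i)" if y: "y \<in> proj {y. \<forall>i. y $ i \<in> C i} x" for y i
    unfolding mem_proj_iff
  proof safe
    show "y $ i \<in> C i" using y by (simp add: mem_proj_iff)
    fix z assume z: "z \<in> C i"
    define y' where "y' = (\<chi> k. if k = i then z else y $ k)"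
    have "y' \<in> {y. \<forall>i. y $ i \<in> C i}" using y z by (auto simp: y'_def mem_proj_iff)
    then have "norm (x - y) \<le> norm (x - y')" using y by (auto simp: mem_proj_iff)
    then have "(norm (x - y))\<^sup>2 \<le> (norm (x - y'))\<^sup>2" by (simp add: power_mono)
    moreover have "(\<Sum>k\<in>UNIV - {i}. (norm ((x - y) $ k))\<^sup>2)
        = (\<Sum>k\<in>UNIV - {i}. (norm ((x - y') $ k))\<^sup>2)"
      by (rule sum.cong) (auto simp: y'_def)
    ultimately have "(norm ((x - y) $ i))\<^sup>2 \<le> (norm ((x - y') $ i))\<^sup>2"
      unfolding nsq by (simp add: sum.remove[of UNIV i])
    then show "norm (x $ i - y $ i) \<le> norm (x $ i - z)"
      using power2_le_imp_le by (fastforce simp: y'_def)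
  qed
  moreover have "y \<in> proj {y. \<forall>i. y $ i \<in> C i} x"
    if y: "\<forall>i. y $ i \<in> proj (C i) (x $ i)" for y
    unfolding mem_proj_iff
  proof safe
    show "y $ i \<in> C i" for i using y by (simp add: mem_proj_iff)
    fix z assume z: "\<forall>i. z $ i \<in> C i"
    have "(norm (x - y))\<^sup>2 \<le> (norm (x - z))\<^sup>2"
      unfolding nsq using y z by (intro sum_mono power_mono) (auto simp: mem_proj_iff)
    then show "norm (x - y) \<le> norm (x - z)" by (rule power2_le_imp_le) simp
  qed
  ultimately show ?thesis by blast
qed

section \<open>The Douglas--Rachford operator of two convex sets\<close>

text \<open>With \<open>a = x - y\<close> and \<open>b\<close>, \<open>d\<close> the differences of the projections onto \<open>A\<close> and \<open>B\<close>, the claim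
  reads \<open>norm (a - b + d)\<^sup>2 + norm (b - d)\<^sup>2 \<le> norm a\<^sup>2\<close>. Expanded, it is the sum of the two firm
  nonexpansiveness inequalities of the projectors, the second one at the reflected points.\<close>

lemma firmly_nonexpansive_DR:
  assumes "convex A" "convex B"
    and p: "\<And>x. p x \<in> proj A x" and q: "\<And>x. q x \<in> proj B (2 *\<^sub>R p x - x)"
  shows "firmly_nonexpansive (\<lambda>x. x - p x + q x)"
  unfolding firmly_nonexpansive_def
proof (intro allI)
  fix x y
  define a b d where abd: "a = x - y" "b = p x - p y" "d = q x - q y"
  have b: "inner b b \<le> inner b a"
    using proj_convex_firm[OF assms(1) p p] by (simp add: abd power2_norm_eq_inner)
  have "inner d d \<le> inner d ((2 *\<^sub>R p x - x) - (2 *\<^sub>R p y - y))"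
    using proj_convex_firm[OF assms(2) q q] by (simp add: abd power2_norm_eq_inner)
  also have "(2 *\<^sub>R p x - x) - (2 *\<^sub>R p y - y) = 2 *\<^sub>R b - a"
    by (simp add: abd algebra_simps)
  finally have d: "inner d d \<le> 2 * inner d b - inner d a"
    by (simp add: inner_simps)
  have F: "(x - p x + q x) - (y - p y + q y) = a - b + d"
    "(x - (x - p x + q x)) - (y - (y - p y + q y)) = b - d"
    by (simp_all add: abd)
  show "(norm ((x - p x + q x) - (y - p y + q y)))\<^sup>2
      + (norm ((x - (x - p x + q x)) - (y - (y - p y + q y))))\<^sup>2 \<le> (norm (x - y))\<^sup>2"
    unfolding F abd(1)[symmetric] power2_norm_eq_inner
    using b d by (simp add: inner_simps inner_commute)
qed

lemma DR_op_diagW: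
  "DR_op diagW V x = {x - P_W x + q | q. q \<in> proj V (R_W x)}"
proof -
  have "(1/2) *\<^sub>R (x + (2 *\<^sub>R c - R_W x)) = x - P_W x + c" for c
    by (simp add: R_W_def algebra_simps flip: scaleR_2)
  then show ?thesis
    by (auto simp: DR_op_def sv_comp_def sv_image_def reflector_diagW reflector_def[of V]) metis
qed

section \<open>Asymptotic centers and weak convergence\<close>

text \<open>If \<open>z\<close> and \<open>w\<close> are both within \<open>c\<close> of a point, their midpoint is closer to it by the
  parallelogram law. When no center is eventually within less than \<open>\<rho>\<close> of the sequence, this
  bounds the distance of \<open>z\<close> and \<open>w\<close>.\<close>

lemma almost_centers_close:
  fixes x :: "'b \<Rightarrow> 'a::real_inner"
  assumes min: "\<And>w c. eventually (\<lambda>n. norm (x n - w) \<le> c) G \<Longrightarrow> \<rho> \<le> c" and "0 \<le> \<rho>"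
    and z: "eventually (\<lambda>n. norm (x n - z) \<le> c) G"
    and w: "eventually (\<lambda>n. norm (x n - w) \<le> c) G"
  shows "\<rho>\<^sup>2 + (norm (z - w))\<^sup>2 / 4 \<le> c\<^sup>2"
proof -
  define s where "s = sqrt \<bar>c\<^sup>2 - (norm (z - w))\<^sup>2 / 4\<bar>"
  have par: "(norm (v - (1/2) *\<^sub>R (z + w)))\<^sup>2
      = ((norm (v - z))\<^sup>2 + (norm (v - w))\<^sup>2) / 2 - (norm (z - w))\<^sup>2 / 4" for v
    unfolding power2_norm_eq_inner by (simp add: inner_simps inner_commute field_simps)
  have mid: "(norm (v - (1/2) *\<^sub>R (z + w)))\<^sup>2 \<le> c\<^sup>2 - (norm (z - w))\<^sup>2 / 4"
    if "norm (v - z) \<le> c" "norm (v - w) \<le> c" for v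
    using par[of v] power_mono[OF that(1), of 2] power_mono[OF that(2), of 2] by simp
  have ev: "eventually (\<lambda>n. (norm (x n - (1/2) *\<^sub>R (z + w)))\<^sup>2 \<le> c\<^sup>2 - (norm (z - w))\<^sup>2 / 4) G"
    using z w by eventually_elim (rule mid)
  have "eventually (\<lambda>n. norm (x n - (1/2) *\<^sub>R (z + w)) \<le> s) G"
    using ev by eventually_elim (auto simp: s_def intro!: real_le_rsqrt)
  then have "\<rho> \<le> s" by (rule min)
  show ?thesis
  proof (cases "0 \<le> c\<^sup>2 - (norm (z - w))\<^sup>2 / 4")
    case True
    with \<open>\<rho> \<le> s\<close> \<open>0 \<le> \<rho>\<close> power_mono[of \<rho> s 2] show ?thesis by (simp add: s_def)
  next
    case False
    \<comment> \<open>A square below a negative number: the filter is trivial, and any radius is admissible, in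
      particular a negative one.\<close>
    have "eventually (\<lambda>n. norm (x n - w) \<le> -1) G"
      using ev by eventually_elim (use False zero_le_power2 order_trans in blast)
    from min[OF this] \<open>0 \<le> \<rho>\<close> show ?thesis by simp
  qed
qed

text \<open>The infimum \<open>\<rho>\<close> of the radii of balls that eventually contain the sequence is attained, since
  the centers of nearly smallest balls form a Cauchy sequence. The last conclusion contains the
  minimality of \<open>\<rho>\<close> and the uniqueness of the center.\<close>

lemma asymptotic_center_exists:
  fixes x :: "'b \<Rightarrow> 'a::{real_inner, complete_space}"
  assumes "G \<noteq> bot" and bounded: "eventually (\<lambda>n. norm (x n - w0) \<le> B) G"
  obtains z \<rho> where "0 \<le> \<rho>"
    "\<And>c. \<rho> < c \<Longrightarrow> eventually (\<lambda>n. norm (x n - z) \<le> c) G"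
    "\<And>w c. eventually (\<lambda>n. norm (x n - w) \<le> c) G \<Longrightarrow> \<rho>\<^sup>2 + (norm (z - w))\<^sup>2 / 4 \<le> c\<^sup>2"
proof -
  define S where "S = {c. \<exists>w. eventually (\<lambda>n. norm (x n - w) \<le> c) G}"
  define \<rho> where "\<rho> = Inf S"
  have nonneg: "0 \<le> c" if "eventually (\<lambda>n. norm (x n - w) \<le> c) G" for w c
    using eventually_happens'[OF assms(1) that] norm_ge_zero order_trans by blast
  have "S \<noteq> {}" using bounded by (auto simp: S_def)
  have "bdd_below S" using nonneg by (intro bdd_belowI[where m = 0]) (auto simp: S_def)
  have min: "\<rho> \<le> c" if "eventually (\<lambda>n. norm (x n - w) \<le> c) G" for w c
    unfolding \<rho>_def using that \<open>bdd_below S\<close> by (intro cInf_lower) (auto simp: S_def)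
  have \<rho>0: "0 \<le> \<rho>"
    unfolding \<rho>_def using \<open>S \<noteq> {}\<close> nonneg by (intro cInf_greatest) (auto simp: S_def)
  have near: "\<exists>w. eventually (\<lambda>n. norm (x n - w) \<le> c) G" if c: "\<rho> < c" for c
  proof -
    obtain c' w where "c' < c" "eventually (\<lambda>n. norm (x n - w) \<le> c') G"
      using cInf_lessD[OF \<open>S \<noteq> {}\<close> c[unfolded \<rho>_def]] unfolding S_def by blast
    then have "eventually (\<lambda>n. norm (x n - w) \<le> c) G"
      by (auto elim!: eventually_mono)
    then show ?thesis by blast
  qed
  define \<delta> where "\<delta> k = \<rho> + inverse (real (Suc k))" for k
  have \<delta>lim: "\<delta> \<longlonglongrightarrow> \<rho>"
    unfolding \<delta>_def using tendsto_add[OF tendsto_const LIMSEQ_inverse_real_of_nat] by force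
  have \<delta>mono: "\<delta> l \<le> \<delta> k" if "k \<le> l" for k l
    using that by (simp add: \<delta>_def)
  have "\<forall>k. \<exists>w. eventually (\<lambda>n. norm (x n - w) \<le> \<delta> k) G"
    using near by (simp add: \<delta>_def)
  then obtain w where w: "\<And>k. eventually (\<lambda>n. norm (x n - w k) \<le> \<delta> k) G"
    by metis
  have close: "(norm (w k - w l))\<^sup>2 \<le> 4 * ((\<delta> N)\<^sup>2 - \<rho>\<^sup>2)" if "N \<le> k" "N \<le> l" for k l N
  proof -
    have "eventually (\<lambda>n. norm (x n - w m) \<le> \<delta> N) G" if "N \<le> m" for m
      using w[of m] by eventually_elim (use \<delta>mono[OF that] in linarith)
    note w' = this
    have "\<rho>\<^sup>2 + (norm (w k - w l))\<^sup>2 / 4 \<le> (\<delta> N)\<^sup>2"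
      by (rule almost_centers_close[OF _ \<rho>0 w'[OF that(1)] w'[OF that(2)]]) (rule min)
    then show ?thesis by simp
  qed
  have "Cauchy w"
  proof (rule CauchyI)
    fix e :: real assume "0 < e"
    have "(\<lambda>N. 4 * ((\<delta> N)\<^sup>2 - \<rho>\<^sup>2)) \<longlonglongrightarrow> 4 * (\<rho>\<^sup>2 - \<rho>\<^sup>2)"
      by (intro tendsto_intros \<delta>lim)
    then have "eventually (\<lambda>N. 4 * ((\<delta> N)\<^sup>2 - \<rho>\<^sup>2) < e\<^sup>2) sequentially"
      by (rule order_tendstoD) (use \<open>0 < e\<close> in simp)
    then obtain N where N: "4 * ((\<delta> N)\<^sup>2 - \<rho>\<^sup>2) < e\<^sup>2"
      by (auto simp: eventually_sequentially)
    have "norm (w k - w l) < e" if "N \<le> k" "N \<le> l" for k l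
      by (rule power2_less_imp_less[of _ e]) (use close[OF that] N \<open>0 < e\<close> in simp_all)
    then show "\<exists>M. \<forall>m\<ge>M. \<forall>n\<ge>M. norm (w m - w n) < e" by blast
  qed
  then obtain z where z: "w \<longlonglongrightarrow> z"
    using Cauchy_convergent convergent_def by blast
  have center: "eventually (\<lambda>n. norm (x n - z) \<le> c) G" if "\<rho> < c" for c
  proof -
    have "(\<lambda>k. \<delta> k + norm (w k - z)) \<longlonglongrightarrow> \<rho> + norm (z - z)"
      by (intro tendsto_intros \<delta>lim z)
    then have "eventually (\<lambda>k. \<delta> k + norm (w k - z) < c) sequentially"
      by (rule order_tendstoD) (use that in simp)
    then obtain k where k: "\<delta> k + norm (w k - z) < c"
      by (auto simp: eventually_sequentially)
    show ?thesis using w[of k]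
    proof eventually_elim
      case (elim n)
      have "norm (x n - z) \<le> norm (x n - w k) + norm (w k - z)"
        using norm_triangle_ineq[of "x n - w k" "w k - z"] by simp
      with elim k show ?case by linarith
    qed
  qed
  have "\<rho>\<^sup>2 + (norm (z - v))\<^sup>2 / 4 \<le> c\<^sup>2"
    if v: "eventually (\<lambda>n. norm (x n - v) \<le> c) G" for v c
  proof (rule LIMSEQ_le_const)
    \<comment> \<open>The radius \<open>c\<close> may equal \<open>\<rho>\<close>, for which \<open>z\<close> need not be an eventual center; hence the
      detour over slightly larger radii.\<close>
    have "(\<lambda>k. (c + inverse (real (Suc k)))\<^sup>2) \<longlonglongrightarrow> (c + 0)\<^sup>2"
      by (intro tendsto_intros LIMSEQ_inverse_real_of_nat)
    then show "(\<lambda>k. (c + inverse (real (Suc k)))\<^sup>2) \<longlonglongrightarrow> c\<^sup>2" by simp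
    have "\<rho>\<^sup>2 + (norm (z - v))\<^sup>2 / 4 \<le> (c + inverse (real (Suc k)))\<^sup>2" for k
    proof (rule almost_centers_close[OF _ \<rho>0], erule min)
      have pos: "0 < inverse (real (Suc k))" by simp
      then show "eventually (\<lambda>n. norm (x n - z) \<le> c + inverse (real (Suc k))) G"
        by (intro center) (use min[OF v] in linarith)
      show "eventually (\<lambda>n. norm (x n - v) \<le> c + inverse (real (Suc k))) G"
        using v by eventually_elim (use pos in linarith)
    qed
    then show "\<exists>N. \<forall>k\<ge>N. \<rho>\<^sup>2 + (norm (z - v))\<^sup>2 / 4 \<le> (c + inverse (real (Suc k)))\<^sup>2" by blast
  qed
  with \<rho>0 center show thesis by (rule that)
qed

text \<open>Applying \<open>F\<close> maps a ball about \<open>z\<close> into the ball of the same radius about \<open>F z\<close>, and it moves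
  the sequence by a vanishing amount; thus \<open>F z\<close> is an asymptotic center as well,
  and by uniqueness it equals \<open>z\<close>.\<close>

lemma asymptotic_center_fixed:
  fixes x :: "nat \<Rightarrow> 'a::real_inner"
  assumes nonexp: "\<And>x y. norm (F x - F y) \<le> norm (x - y)"
    and iter: "\<And>n. x (Suc n) = F (x n)"
    and regular: "(\<lambda>n. norm (x n - x (Suc n))) \<longlonglongrightarrow> 0"
    and "G \<le> sequentially"
    and "0 \<le> \<rho>" and center: "\<And>c. \<rho> < c \<Longrightarrow> eventually (\<lambda>n. norm (x n - z) \<le> c) G"
    and unique: "\<And>w c. eventually (\<lambda>n. norm (x n - w) \<le> c) G \<Longrightarrow> \<rho>\<^sup>2 + (norm (z - w))\<^sup>2 / 4 \<le> c\<^sup>2"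
  shows "F z = z"
proof -
  have "\<rho>\<^sup>2 + (norm (z - F z))\<^sup>2 / 4 \<le> \<rho>\<^sup>2"
  proof (rule LIMSEQ_le_const)
    have "(\<lambda>k. (\<rho> + 2 * inverse (real (Suc k)))\<^sup>2) \<longlonglongrightarrow> (\<rho> + 2 * 0)\<^sup>2"
      by (intro tendsto_intros LIMSEQ_inverse_real_of_nat)
    then show "(\<lambda>k. (\<rho> + 2 * inverse (real (Suc k)))\<^sup>2) \<longlonglongrightarrow> \<rho>\<^sup>2" by simp
    have "\<rho>\<^sup>2 + (norm (z - F z))\<^sup>2 / 4 \<le> (\<rho> + 2 * inverse (real (Suc k)))\<^sup>2" for k
    proof (rule unique)
      define d where "d = inverse (real (Suc k))"
      have "0 < d" by (simp add: d_def)
      then have "eventually (\<lambda>n. norm (x n - x (Suc n)) < d) sequentially"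
        using order_tendstoD(2)[OF regular] by blast
      then have "eventually (\<lambda>n. norm (x n - x (Suc n)) < d) G"
        using assms(4) filter_leD by blast
      moreover have "eventually (\<lambda>n. norm (x n - z) \<le> \<rho> + d) G"
        by (rule center) (use \<open>0 < d\<close> in simp)
      ultimately show "eventually (\<lambda>n. norm (x n - F z) \<le> \<rho> + 2 * d) G"
      proof eventually_elim
        case (elim n)
        have "norm (x n - F z) \<le> norm (x n - x (Suc n)) + norm (F (x n) - F z)"
          using norm_triangle_ineq[of "x n - x (Suc n)" "x (Suc n) - F z"] by (simp add: iter)
        with elim nonexp[of "x n" z] show ?case by linarith
      qed
    qed
    then show "\<exists>N. \<forall>k\<ge>N. \<rho>\<^sup>2 + (norm (z - F z))\<^sup>2 / 4 \<le> (\<rho> + 2 * inverse (real (Suc k)))\<^sup>2" by blast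
  qed
  then show ?thesis by simp
qed

text \<open>The weak limit is the asymptotic center of the whole sequence. Fixed points serve as a link
  between the sequence and its subsequences: for a fixed point, the distances decrease, so a single
  bound on them holds from there on.\<close>

theorem nonexpansive_iteration_weakly_converges:
  fixes x :: "nat \<Rightarrow> 'a::{real_inner, complete_space}"
  assumes nonexp: "\<And>x y. norm (F x - F y) \<le> norm (x - y)"
    and iter: "\<And>n. x (Suc n) = F (x n)"
    and regular: "(\<lambda>n. norm (x n - x (Suc n))) \<longlonglongrightarrow> 0"
    and "F p = p"
  obtains z where "F z = z" "weakly_converges x z"
proof -
  have decr: "norm (x m - q) \<le> norm (x n - q)" if "F q = q" "n \<le> m" for q m n
    using that(2)
  proof (induction m rule: dec_induct)
    case (step m)
    then show ?case using nonexp[of "x m" q] that(1) by (simp add: iter)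
  qed simp
  have bounded: "eventually (\<lambda>n. norm (x n - p) \<le> norm (x 0 - p)) G" for G
    by (intro always_eventually allI decr assms(4)) simp
  obtain z \<rho> where \<rho>0: "0 \<le> \<rho>"
    and z: "\<And>c. \<rho> < c \<Longrightarrow> eventually (\<lambda>n. norm (x n - z) \<le> c) sequentially"
    and min: "\<And>w c. eventually (\<lambda>n. norm (x n - w) \<le> c) sequentially
      \<Longrightarrow> \<rho>\<^sup>2 + (norm (z - w))\<^sup>2 / 4 \<le> c\<^sup>2"
    by (rule asymptotic_center_exists[OF sequentially_bot bounded], rule that)
  have "F z = z"
    by (rule asymptotic_center_fixed[OF nonexp iter regular order_refl \<rho>0 z min])
  have upper: "eventually (\<lambda>n. inner (x n - z) u < \<epsilon>) sequentially" if "0 < \<epsilon>" for u \<epsilon>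
  proof (rule ccontr)
    assume not_ev: "\<not> ?thesis"
    \<comment> \<open>Restricting the index filter to the bad indices plays the role of a subsequence.\<close>
    define G where "G = inf sequentially (principal {n. \<epsilon> \<le> inner (x n - z) u})"
    have G_le: "G \<le> sequentially" by (simp add: G_def)
    have "G \<noteq> bot"
      using not_ev by (simp add: G_def trivial_limit_def eventually_inf_principal not_le)
    obtain z' \<rho>' where \<rho>'0: "0 \<le> \<rho>'"
      and z': "\<And>c. \<rho>' < c \<Longrightarrow> eventually (\<lambda>n. norm (x n - z') \<le> c) G"
      and min': "\<And>w c. eventually (\<lambda>n. norm (x n - w) \<le> c) G
        \<Longrightarrow> \<rho>'\<^sup>2 + (norm (z' - w))\<^sup>2 / 4 \<le> c\<^sup>2"
      by (rule asymptotic_center_exists[OF \<open>G \<noteq> bot\<close> bounded], rule that)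
    have fix': "F z' = z'"
      by (rule asymptotic_center_fixed[OF nonexp iter regular G_le \<rho>'0 z' min'])
    have "\<rho> \<le> \<rho>'"
    proof (rule dense_ge)
      fix c assume "\<rho>' < c"
      obtain n where "norm (x n - z') \<le> c"
        using eventually_happens'[OF \<open>G \<noteq> bot\<close> z'[OF \<open>\<rho>' < c\<close>]] by blast
      then have "eventually (\<lambda>m. norm (x m - z') \<le> c) sequentially"
        using decr[OF fix'] order_trans unfolding eventually_sequentially by blast
      from min[OF this] have "\<rho>\<^sup>2 \<le> c\<^sup>2"
        using zero_le_power2[of "norm (z - z')"] by linarith
      then show "\<rho> \<le> c" by (rule power2_le_imp_le) (use \<open>\<rho>' < c\<close> \<rho>'0 in simp)
    qed
    \<comment> \<open>The step \<open>t\<close> is chosen so that the gain \<open>2 t \<epsilon>\<close> exceeds the loss \<open>t\<^sup>2 (norm u)\<^sup>2\<close>; adding 1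
      keeps it defined for \<open>u = 0\<close>.\<close>
    define t where "t = \<epsilon> / ((norm u)\<^sup>2 + 1)"
    have "0 < (norm u)\<^sup>2 + 1" by (simp add: add_nonneg_pos)
    then have "0 < t" "t * (norm u)\<^sup>2 < \<epsilon>"
      using that by (auto simp: t_def field_simps)
    then have gain: "t\<^sup>2 * (norm u)\<^sup>2 < t * \<epsilon>"
      by (simp add: power2_eq_square)
    have shifted: "\<rho>'\<^sup>2 \<le> c\<^sup>2 - t * \<epsilon>" if "\<rho> < c" for c
    proof -
      have "eventually (\<lambda>n. \<epsilon> \<le> inner (x n - z) u) G"
        by (simp add: G_def eventually_inf_principal)
      moreover have "eventually (\<lambda>n. norm (x n - z) \<le> c) G"
        using z[OF that] G_le filter_leD by blast
      ultimately have ev: "eventually (\<lambda>n. (norm (x n - (z + t *\<^sub>R u)))\<^sup>2 \<le> c\<^sup>2 - t * \<epsilon>) G"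
      proof eventually_elim
        case (elim n)
        have "(norm (x n - (z + t *\<^sub>R u)))\<^sup>2
            = (norm (x n - z))\<^sup>2 - 2 * t * inner (x n - z) u + t\<^sup>2 * (norm u)\<^sup>2"
          unfolding power2_norm_eq_inner
          by (simp add: inner_simps inner_commute power2_eq_square algebra_simps)
        moreover have "(norm (x n - z))\<^sup>2 \<le> c\<^sup>2" using elim by (simp add: power_mono)
        moreover have "t * \<epsilon> \<le> t * inner (x n - z) u" using elim \<open>0 < t\<close> by simp
        ultimately show ?case using gain by linarith
      qed
      have nonneg: "0 \<le> c\<^sup>2 - t * \<epsilon>"
        using eventually_happens'[OF \<open>G \<noteq> bot\<close> ev] zero_le_power2 order_trans by blast
      have "eventually (\<lambda>n. norm (x n - (z + t *\<^sub>R u)) \<le> sqrt (c\<^sup>2 - t * \<epsilon>)) G"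
        using ev by eventually_elim (rule real_le_rsqrt)
      from min'[OF this] show ?thesis
        unfolding real_sqrt_pow2[OF nonneg]
        using zero_le_power2[of "norm (z' - (z + t *\<^sub>R u))"] by linarith
    qed
    have "\<rho>'\<^sup>2 \<le> \<rho>\<^sup>2 - t * \<epsilon>"
    proof (rule LIMSEQ_le_const)
      have "(\<lambda>k. (\<rho> + inverse (real (Suc k)))\<^sup>2 - t * \<epsilon>) \<longlonglongrightarrow> (\<rho> + 0)\<^sup>2 - t * \<epsilon>"
        by (intro tendsto_intros LIMSEQ_inverse_real_of_nat)
      then show "(\<lambda>k. (\<rho> + inverse (real (Suc k)))\<^sup>2 - t * \<epsilon>) \<longlonglongrightarrow> \<rho>\<^sup>2 - t * \<epsilon>" by simp
      show "\<exists>N. \<forall>k\<ge>N. \<rho>'\<^sup>2 \<le> (\<rho> + inverse (real (Suc k)))\<^sup>2 - t * \<epsilon>"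
        by (intro exI allI impI shifted) simp
    qed
    moreover have "\<rho>\<^sup>2 \<le> \<rho>'\<^sup>2" using \<open>\<rho> \<le> \<rho>'\<close> \<rho>0 by (simp add: power_mono)
    moreover have "0 < t * \<epsilon>" using \<open>0 < t\<close> \<open>0 < \<epsilon>\<close> by simp
    ultimately show False by linarith
  qed
  have "weakly_converges x z"
    unfolding weakly_converges_def
  proof
    fix u
    show "(\<lambda>n. inner (x n) u) \<longlonglongrightarrow> inner z u"
    proof (rule tendstoI)
      fix \<epsilon> :: real assume "0 < \<epsilon>"
      show "eventually (\<lambda>n. dist (inner (x n) u) (inner z u) < \<epsilon>) sequentially"
        using upper[OF \<open>0 < \<epsilon>\<close>, of u] upper[OF \<open>0 < \<epsilon>\<close>, of "- u"]
        by eventually_elim (simp add: dist_real_def inner_simps abs_less_iff)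
    qed
  qed
  with \<open>F z = z\<close> that show thesis by blast
qed

text \<open>For firmly nonexpansive maps the squared step lengths are bounded by the decrements of the
  convergent sequence of squared distances to a fixed point, so they vanish in the limit.\<close>

lemma firmly_nonexpansive_iteration_weakly_converges:
  fixes x :: "nat \<Rightarrow> 'a::{real_inner, complete_space}"
  assumes firm: "firmly_nonexpansive F" and iter: "\<And>n. x (Suc n) = F (x n)" and "F p = p"
  obtains z where "F z = z" "weakly_converges x z"
proof -
  have ineq: "(norm (F v - F w))\<^sup>2 + (norm ((v - F v) - (w - F w)))\<^sup>2 \<le> (norm (v - w))\<^sup>2" for v w
    using firm by (simp add: firmly_nonexpansive_def)
  have nonexp: "norm (F v - F w) \<le> norm (v - w)" for v w
    by (rule power2_le_imp_le)
      (use ineq[of v w] zero_le_power2[of "norm ((v - F v) - (w - F w))"] in linarith, simp)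
  define d where "d n = (norm (x n - p))\<^sup>2" for n
  have step: "d (Suc n) + (norm (x n - x (Suc n)))\<^sup>2 \<le> d n" for n
    using ineq[of "x n" p] assms(3) by (simp add: d_def iter)
  have "d (Suc n) \<le> d n" for n
    using step[of n] zero_le_power2[of "norm (x n - x (Suc n))"] by linarith
  then have "decseq d" by (rule decseq_SucI)
  moreover have "0 \<le> d n" for n by (simp add: d_def)
  ultimately obtain L where "d \<longlonglongrightarrow> L"
    using decseq_convergent by blast
  then have "(\<lambda>n. d n - d (Suc n)) \<longlonglongrightarrow> L - L"
    by (intro tendsto_diff LIMSEQ_Suc)
  then have "(\<lambda>n. d n - d (Suc n)) \<longlonglongrightarrow> 0" by simp
  then have "(\<lambda>n. (norm (x n - x (Suc n)))\<^sup>2) \<longlonglongrightarrow> 0"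
  proof (rule tendsto_sandwich[OF _ _ tendsto_const, rotated 2])
    show "eventually (\<lambda>n. (norm (x n - x (Suc n)))\<^sup>2 \<le> d n - d (Suc n)) sequentially"
      by (intro always_eventually allI) (use step in \<open>smt (verit)\<close>)
  qed simp
  then have "(\<lambda>n. norm (x n - x (Suc n))) \<longlonglongrightarrow> 0"
    using tendsto_real_sqrt by fastforce
  from nonexpansive_iteration_weakly_converges[OF nonexp iter this assms(3)] that
  show thesis by blast
qed

lemma weakly_converges_mean:
  fixes x :: "nat \<Rightarrow> 'a::real_inner ^ 'n::finite"
  assumes "weakly_converges x z"
  shows "weakly_converges (\<lambda>n. mean (x n)) (mean z)"
proof -
  have "inner (mean v) u = inner v (\<chi> i. (1 / real CARD('n)) *\<^sub>R u)" for v :: "'a ^ 'n" and u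
    by (simp add: mean_def inner_vec_def inner_sum_left sum_distrib_left)
  with assms show ?thesis by (simp add: weakly_converges_def)
qed

section \<open>The constraint-reduced operator\<close>

lemma all_index_iff:
  fixes e :: "nat \<Rightarrow> 'n::finite"
  assumes "r \<ge> 2" and e: "bij_betw e {1..r-1} (UNIV :: 'n set)"
  shows "(\<forall>i. P i) \<longleftrightarrow> (\<forall>j\<in>{1..r-2}. P (e j)) \<and> P (e (r-1))"
proof -
  have "{1..r-1} = insert (r-1) {1..r-2}" using assms(1) by auto
  then have "UNIV = insert (e (r-1)) (e ` {1..r-2})"
    using bij_betw_imp_surj_on[OF e] by simp
  then have "(\<forall>i. P i) \<longleftrightarrow> (\<forall>i\<in>insert (e (r-1)) (e ` {1..r-2}). P i)" by simp
  then show ?thesis by auto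
qed

text \<open>Turns data given by labels, with an exceptional value \<open>l\<close> at the last label, into a family
  over the coordinates. With sets as values it exhibits \<open>V\<close> as a product over the index type; with
  points as values it yields vectors.\<close>

lemma indexed_family_exists:
  fixes e :: "nat \<Rightarrow> 'n::finite"
  assumes "r \<ge> 2" and e: "bij_betw e {1..r-1} (UNIV :: 'n set)"
  obtains C where "\<And>j. j \<in> {1..r-2} \<Longrightarrow> C (e j) = f j" "C (e (r-1)) = l"
proof -
  define C where "C i = (let j = the_inv_into {1..r-1} e i in if j = r - 1 then l else f j)" for i
  have inv: "the_inv_into {1..r-1} e (e j) = j" if "j \<in> {1..r-1}" for j
    using the_inv_into_f_f[OF bij_betw_imp_inj_on[OF e]] that by blast
  have "C (e j) = f j" if "j \<in> {1..r-2}" for j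
  proof -
    from that assms(1) have "j \<in> {1..r-1}" "j \<noteq> r - 1" by auto
    then show ?thesis by (simp add: C_def Let_def inv del: One_nat_def)
  qed
  moreover have "C (e (r-1)) = l"
    using inv[of "r-1"] assms(1) by (simp add: C_def Let_def)
  ultimately show thesis by (rule that)
qed

lemma Q_V_eq_proj_prodV:
  fixes e :: "nat \<Rightarrow> 'n::finite" and K :: "nat \<Rightarrow> 'a::real_inner set"
  assumes "r \<ge> 2" and e: "bij_betw e {1..r-1} (UNIV :: 'n set)"
    and "proximinal (K (r-1))" "proximinal (K r)"
    and "sv_image (proj (K (r-1))) (K r) \<subseteq> K r" and "affine (K r)"
  shows "Q_V e r K x = proj (prodV e r K) x"
proof -
  obtain C where C: "\<And>j. j \<in> {1..r-2} \<Longrightarrow> C (e j) = K j" "C (e (r-1)) = K (r-1) \<inter> K r"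
    using indexed_family_exists[OF assms(1,2), of K "K (r-1) \<inter> K r"] by blast
  have V: "prodV e r K = {x. \<forall>i. x $ i \<in> C i}"
    unfolding prodV_def all_index_iff[OF assms(1,2)] by (simp add: C del: One_nat_def)
  show ?thesis
    unfolding V proj_product unfolding Q_V_def all_index_iff[OF assms(1,2)]
    by (simp add: C proj_Int_affine[OF assms(6,3,4,5)] del: One_nat_def)
qed

lemma convex_prodV:
  assumes "r \<ge> 2" "\<forall>j\<in>{1..r-1}. convex (K j)" "affine (K r)"
  shows "convex (prodV e r K)"
proof (rule convexI)
  fix x y and u v :: real
  assume xy: "x \<in> prodV e r K" "y \<in> prodV e r K" and uv: "0 \<le> u" "0 \<le> v" "u + v = 1"
  have "convex (K (r-1) \<inter> K r)"
    using assms affine_imp_convex[of "K r"] by (intro convex_Int) auto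
  moreover have "convex (K j)" if "j \<in> {1..r-2}" for j using assms that by auto
  ultimately show "u *\<^sub>R x + v *\<^sub>R y \<in> prodV e r K"
    using xy uv convexD[of "K _"] convexD[of "K (r-1) \<inter> K r"] unfolding prodV_def by simp
qed

lemma convex_diagW: "convex diagW"
  unfolding diagW_def by (rule convexI) (simp; metis)

lemma Q_V_nonempty:
  fixes e :: "nat \<Rightarrow> 'n::finite"
  assumes "r \<ge> 2" and e: "bij_betw e {1..r-1} (UNIV :: 'n set)"
    and "\<forall>j\<in>{1..r}. proximinal (K j)"
  shows "Q_V e r K x \<noteq> {}"
proof -
  have ne: "proj (K j) v \<noteq> {}" if "j \<in> {1..r}" for j v
    using assms(3) that by (auto simp: proximinal_def)
  obtain k where "k \<in> proj (K r) (x $ e (r-1))" using ne[of r] assms(1) by auto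
  moreover obtain l where "l \<in> proj (K (r-1)) k" using ne[of "r-1"] assms(1) by fastforce
  ultimately have l: "l \<in> sv_comp (proj (K (r-1))) (proj (K r)) (x $ e (r-1))"
    by (auto simp: sv_comp_def sv_image_def)
  have "\<forall>j\<in>{1..r-2}. \<exists>v. v \<in> proj (K j) (x $ e j)"
    using ne assms(1) by (auto simp: ex_in_conv)
  then obtain f where f: "\<And>j. j \<in> {1..r-2} \<Longrightarrow> f j \<in> proj (K j) (x $ e j)"
    by metis
  obtain y where "\<And>j. j \<in> {1..r-2} \<Longrightarrow> y (e j) = f j" "y (e (r-1)) = l"
    using indexed_family_exists[OF assms(1,2), of f l] by blast
  with f l have "(\<chi> i. y i) \<in> Q_V e r K x" by (simp add: Q_V_def)
  then show ?thesis by blast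
qed

lemma Q_V_subset_prodV:
  assumes "sv_image (proj (K (r-1))) (K r) \<subseteq> K r"
  shows "Q_V e r K x \<subseteq> prodV e r K"
proof
  fix y assume y: "y \<in> Q_V e r K x"
  then obtain k where k: "k \<in> proj (K r) (x $ e (r-1))" "y $ e (r-1) \<in> proj (K (r-1)) k"
    by (auto simp: Q_V_def sv_comp_def sv_image_def)
  then have "y $ e (r-1) \<in> K r"
    using assms proj_subset by (fastforce simp: sv_image_def)
  with y k(2) show "y \<in> prodV e r K"
    using proj_subset by (fastforce simp: Q_V_def prodV_def)
qed

lemma prodV_subset_Q_V: "y \<in> prodV e r K \<Longrightarrow> y \<in> Q_V e r K y"
  by (auto simp: prodV_def Q_V_def sv_comp_def sv_image_def intro!: proj_self bexI[of _ "y $ e (r-1)"])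

lemma P_W_eq_self_iff: "P_W x = x \<longleftrightarrow> x \<in> diagW"
  using proj_self[of x diagW] proj_subset[of diagW x] by (auto simp: proj_diagW)

lemma P_W_in_diagW: "P_W x \<in> diagW"
  by (simp add: P_W_def diagW_def)

lemma Fix_cr_DR_op: "x \<in> Fix (cr_DR_op e r K) \<longleftrightarrow> P_W x \<in> Q_V e r K (R_W x)"
proof -
  have "x = x - P_W x + q \<longleftrightarrow> q = P_W x" for q by (metis add_diff_cancel_left' diff_add_cancel)
  then show ?thesis by (auto simp: Fix_def cr_DR_op_def)
qed

lemma P_W_image_Fix_cr_DR_op:
  assumes "sv_image (proj (K (r-1))) (K r) \<subseteq> K r"
  shows "P_W ` Fix (cr_DR_op e r K) = prodV e r K \<inter> diagW"
proof
  show "P_W ` Fix (cr_DR_op e r K) \<subseteq> prodV e r K \<inter> diagW"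
    using subsetD[OF Q_V_subset_prodV[of K r, OF assms]] P_W_in_diagW
    by (auto simp: Fix_cr_DR_op)
  show "prodV e r K \<inter> diagW \<subseteq> P_W ` Fix (cr_DR_op e r K)"
  proof
    fix y assume y: "y \<in> prodV e r K \<inter> diagW"
    then have "P_W y = y" by (simp add: P_W_eq_self_iff)
    then have "y \<in> Fix (cr_DR_op e r K)"
      using y prodV_subset_Q_V by (auto simp: Fix_cr_DR_op R_W_def scaleR_2)
    with \<open>P_W y = y\<close> show "y \<in> P_W ` Fix (cr_DR_op e r K)" by force
  qed
qed

lemma const_in_prodV_iff:
  assumes "r \<ge> 2"
  shows "(\<chi> i. c) \<in> prodV e r K \<longleftrightarrow> c \<in> (\<Inter>j\<in>{1..r}. K j)"
proof -
  have "{1..r} = {1..r-2} \<union> {r-1, r}" using assms by auto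
  then show ?thesis by (auto simp: prodV_def)
qed

theorem theorem3p9:
  fixes r :: nat
    and K :: "nat \<Rightarrow> 'a::{real_inner, complete_space} set"
    and e :: "nat \<Rightarrow> 'n::finite"
  assumes "r \<ge> 2"
    and "bij_betw e {1..r-1} (UNIV :: 'n set)"
    and "\<forall>j\<in>{1..r}. proximinal (K j)"
    and "(\<Inter>j\<in>{1..r}. K j) \<noteq> {}"
    and "sv_image (proj (K (r-1))) (K r) \<subseteq> K r"
  shows
    "(P_W ` Fix (cr_DR_op e r K) = prodV e r K \<inter> diagW \<and>
      (\<forall>x\<in>Fix (cr_DR_op e r K). mean x \<in> (\<Inter>j\<in>{1..r}. K j))) \<and>
     (affine (K r) \<longrightarrow> cr_DR_op e r K = DR_op diagW (prodV e r K)) \<and>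
     ((\<forall>j\<in>{1..r-1}. convex (K j)) \<and> affine (K r) \<longrightarrow>
       (\<exists>F. (\<forall>x. cr_DR_op e r K x = {F x}) \<and>
            firmly_nonexpansive F \<and>
            (\<forall>x0. \<forall>x :: nat \<Rightarrow> 'a ^ 'n. x 0 = x0 \<and> (\<forall>n. x (Suc n) = F (x n)) \<longrightarrow>
               (\<exists>xs\<in>Fix (cr_DR_op e r K).
                  weakly_converges x xs \<and>
                  weakly_converges (\<lambda>n. mean (x n)) (mean xs) \<and>
                  mean xs \<in> (\<Inter>j\<in>{1..r}. K j)))))"
proof -
  let ?T = "cr_DR_op e r K" and ?V = "prodV e r K"
  have fix_image: "P_W ` Fix ?T = ?V \<inter> diagW"
    by (rule P_W_image_Fix_cr_DR_op[OF assms(5)])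
  have mean_fix: "mean x \<in> (\<Inter>j\<in>{1..r}. K j)" if "x \<in> Fix ?T" for x
  proof -
    have "P_W x \<in> ?V" using fix_image that by blast
    then show ?thesis unfolding P_W_def const_in_prodV_iff[OF assms(1)] .
  qed
  have Q: "Q_V e r K x = proj ?V x" if "affine (K r)" for x
    using assms that by (intro Q_V_eq_proj_prodV) auto
  have b: "?T = DR_op diagW ?V" if "affine (K r)"
    by (rule ext) (simp add: DR_op_diagW cr_DR_op_def Q[OF that])
  have c: "\<exists>F. (\<forall>x. ?T x = {F x}) \<and> firmly_nonexpansive F \<and>
      (\<forall>x0. \<forall>x :: nat \<Rightarrow> 'a ^ 'n. x 0 = x0 \<and> (\<forall>n. x (Suc n) = F (x n)) \<longrightarrow>
        (\<exists>xs\<in>Fix ?T. weakly_converges x xs \<and> weakly_converges (\<lambda>n. mean (x n)) (mean xs) \<and>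
          mean xs \<in> (\<Inter>j\<in>{1..r}. K j)))"
    if conv: "\<forall>j\<in>{1..r-1}. convex (K j)" and aff: "affine (K r)"
  proof -
    have convV: "convex ?V" by (rule convex_prodV[OF assms(1) conv aff])
    have "\<forall>x. \<exists>q. q \<in> proj ?V (R_W x)"
      using Q_V_nonempty[OF assms(1-3)] Q[OF aff] by blast
    then obtain q where q: "\<And>x. q x \<in> proj ?V (R_W x)" by metis
    then have q_unique: "proj ?V (R_W x) = {q x}" for x
      using proj_convex_unique[OF convV] by blast
    define F where "F x = x - P_W x + q x" for x
    have T: "?T x = {F x}" for x
      by (simp add: cr_DR_op_def Q[OF aff] q_unique F_def)
    have firm: "firmly_nonexpansive F"
      unfolding F_def
      by (rule firmly_nonexpansive_DR[OF convex_diagW convV])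
        (use q in \<open>simp_all add: proj_diagW R_W_def\<close>)
    have Fix_F: "x \<in> Fix ?T \<longleftrightarrow> F x = x" for x by (auto simp: Fix_def T)
    obtain c where "c \<in> (\<Inter>j\<in>{1..r}. K j)" using assms(4) by blast
    then have "(\<chi> i. c) \<in> ?V \<inter> diagW"
      using const_in_prodV_iff[OF assms(1)] by (auto simp: diagW_def)
    then obtain p where "F p = p" unfolding fix_image[symmetric] using Fix_F by blast
    have "\<exists>xs\<in>Fix ?T. weakly_converges x xs \<and> weakly_converges (\<lambda>n. mean (x n)) (mean xs) \<and>
        mean xs \<in> (\<Inter>j\<in>{1..r}. K j)" if iter: "\<And>n. x (Suc n) = F (x n)" for x :: "nat \<Rightarrow> 'a ^ 'n"
    proof -
      obtain z where "F z = z" "weakly_converges x z"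
        using firmly_nonexpansive_iteration_weakly_converges[where x = x, OF firm iter \<open>F p = p\<close>]
        by blast
      then show ?thesis using weakly_converges_mean mean_fix Fix_F by blast
    qed
    with T firm show ?thesis by blast
  qed
  show ?thesis using fix_image mean_fix b c by blast
qed

end
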